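(* Let $\mathbb{Z}$ be a finite dimensional real inner product space with induced norm $\|\cdot\|$, let $\mathcal{A}:\mathbb{Z}\rightrightarrows\mathbb{Z}$ be maximal monotone, let $\mathcal{B}:\mathbb{Z}\to\mathbb{Z}$ be single-valued and Lipschitz continuous with modulus $\frac1\beta$ ($\beta>0$), let $\gamma>0$, and define the single-valued mapping $\mathcal{R}(z)=z-\mathcal{J}_{\gamma\mathcal{A}}(\mathcal{I}-\gamma\mathcal{B})z$ for $z\in\mathbb{Z}$. Let $z^*\in\mathbb{Z}$ satisfy $0=\mathcal{R}(z^* )$. If there exist constants $\kappa''>0$ and $\delta''>0$ such that the projection type error bound $${\rm dist}\big(z,\mathcal{R}^{-1}(0)\big)\le\kappa''\|\mathcal{R}(z)\|\qquad\text{for all }z\in\mathbb{Z}\text{ with }\|\mathcal{R}(z)\|\le\delta''$$ holds, then $\mathcal{R}$ is metrically subregular at $z^*$ for $0\in\mathcal{R}(z^* )$.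
   Context: For an operator $\mathcal{T}:\mathbb{Z}\rightrightarrows\mathbb{Z}$ (set-valued map) and $\gamma>0$, $\mathcal{J}_{\gamma\mathcal{T}}=(\mathcal{I}+\gamma\mathcal{T})^{-1}$ denotes its resolvent, where $\mathcal{I}$ is the identity. $\mathcal{T}^{-1}(y)=\{x: y\in\mathcal{T}(x)\}$, and ${\rm dist}(x,S)=\inf_{s\in S}\|x-s\|$. Lipschitz continuous with modulus $\frac1\beta$ means $\|\mathcal{B}u-\mathcal{B}v\|\le\beta^{-1}\|u-v\|$ for all $u,v$. An operator $\mathcal{T}$ (single-valued mappings being regarded as operators) is metrically subregular at $\overline{x}$ for $\overline{y}\in\mathcal{T}(\overline{x})$ if there exist a constant $\kappa>0$ and a neighborhood $U$ of $\overline{x}$ such that ${\rm dist}(x,\mathcal{T}^{-1}(\overline{y}))\le\kappa\,{\rm dist}(\overline{y},\mathcal{T}x)$ for all $x\in U$. *)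

theory Defs
  imports "HOL-Analysis.Analysis"
begin

text \<open>
  A set-valued operator is a function into sets; the domain need not be the whole space,
  since values may be empty. A single-valued map \<open>f\<close> is regarded as the operator \<open>\<lambda>x. {f x}\<close>.
\<close>

definition op_inverse :: "('a \<Rightarrow> 'b set) \<Rightarrow> 'b \<Rightarrow> 'a set" where
  "op_inverse T y = {x. y \<in> T x}"

definition monotone_op :: "('a::real_inner \<Rightarrow> 'a set) \<Rightarrow> bool" where
  "monotone_op T \<longleftrightarrow> (\<forall>x y. \<forall>u\<in>T x. \<forall>v\<in>T y. inner (x - y) (u - v) \<ge> 0)"

definition maximal_monotone :: "('a::real_inner \<Rightarrow> 'a set) \<Rightarrow> bool" where
  "maximal_monotone T \<longleftrightarrow>
     monotone_op T \<and> (\<forall>S. monotone_op S \<and> (\<forall>x. T x \<subseteq> S x) \<longrightarrow> S = T)"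

definition resolvent :: "real \<Rightarrow> ('a::real_vector \<Rightarrow> 'a set) \<Rightarrow> 'a \<Rightarrow> 'a set" where
  "resolvent \<gamma> T = op_inverse (\<lambda>x. (\<lambda>u. x + \<gamma> *\<^sub>R u) ` T x)"

text \<open>
  The use of \<^const>\<open>the_elem\<close> is meaningful when every value of the resolvent is a singleton;
  by Minty's theorem this is so for maximal monotone \<open>A\<close> and \<open>\<gamma> > 0\<close> on a
  finite-dimensional inner product space.
\<close>

definition fb_residual ::
    "real \<Rightarrow> ('a::real_vector \<Rightarrow> 'a set) \<Rightarrow> ('a \<Rightarrow> 'a) \<Rightarrow> 'a \<Rightarrow> 'a" where
  "fb_residual \<gamma> A B z = z - the_elem (resolvent \<gamma> A (z - \<gamma> *\<^sub>R B z))"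

text \<open>
  \<^const>\<open>infdist\<close> is 0 for the empty set, whereas the distance to the empty set is
  \<open>\<infinity>\<close> here; the guard \<open>T x \<noteq> {}\<close> restores that convention on the right-hand side. On the
  left the set contains \<open>xbar\<close>.
\<close>

definition metrically_subregular ::
    "('a::metric_space \<Rightarrow> 'b::metric_space set) \<Rightarrow> 'a \<Rightarrow> 'b \<Rightarrow> bool" where
  "metrically_subregular T xbar ybar \<longleftrightarrow>
     ybar \<in> T xbar \<and>
     (\<exists>\<kappa>>0. \<exists>U. open U \<and> xbar \<in> U \<and>
        (\<forall>x\<in>U. T x \<noteq> {} \<longrightarrow> infdist x (op_inverse T ybar) \<le> \<kappa> * infdist ybar (T x)))"

end

theory Submission
  imports Defs
begin

text \<open>
  A residual error bound, valid where \<open>norm (R z) \<le> \<delta>\<close>, extends at once to the ball of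
  radius \<open>\<kappa> * \<delta>\<close> around any zero \<open>zstar\<close> of \<open>R\<close>: at a point of this ball with
  \<open>norm (R z) > \<delta>\<close>, the distance from \<open>z\<close> to the zero set is at most
  \<open>dist z zstar < \<kappa> * \<delta> < \<kappa> * norm (R z)\<close>. So the error bound holds, with the same
  constant \<open>\<kappa>\<close>, on a neighbourhood of \<open>zstar\<close>, and this is metric subregularity. The
  argument applies to an arbitrary map \<open>R\<close> and does not go through continuity, which for the
  forward-backward residual would give \<open>norm (R z) \<le> \<delta>\<close> near \<open>zstar\<close>.
\<close>

lemma metrically_subregular_if_residual_error_bound:
  fixes R :: "'a::metric_space \<Rightarrow> 'b::real_normed_vector"
  assumes zero: "R zstar = 0"
    and \<kappa>: "\<kappa> > 0" and \<delta>: "\<delta> > 0"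
    and bound: "\<And>z. norm (R z) \<le> \<delta> \<Longrightarrow>
          infdist z (op_inverse (\<lambda>z. {R z}) 0) \<le> \<kappa> * norm (R z)"
  shows "metrically_subregular (\<lambda>z. {R z}) zstar 0"
proof -
  let ?S = "op_inverse (\<lambda>z. {R z}) 0"
  have near: "infdist z ?S \<le> \<kappa> * norm (R z)" if z: "z \<in> ball zstar (\<kappa> * \<delta>)" for z
  proof (cases "norm (R z) \<le> \<delta>")
    case True
    then show ?thesis by (rule bound)
  next
    case False
    have "zstar \<in> ?S"
      by (simp add: op_inverse_def zero)
    then have "infdist z ?S \<le> dist z zstar"
      by (rule infdist_le)
    also have "\<dots> \<le> \<kappa> * \<delta>"
      using z by (simp add: dist_commute)
    also have "\<dots> \<le> \<kappa> * norm (R z)"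
      using False \<kappa> by simp
    finally show ?thesis .
  qed
  have rhs: "infdist 0 {R z} = norm (R z)" for z
    by (simp add: infdist_def)
  show ?thesis
    unfolding metrically_subregular_def rhs
  proof (intro conjI exI[of _ \<kappa>] exI[of _ "ball zstar (\<kappa> * \<delta>)"] ballI impI)
    show "zstar \<in> ball zstar (\<kappa> * \<delta>)"
      using \<kappa> \<delta> by simp
  qed (use zero \<kappa> near in simp_all)
qed

theorem lemma3p4:
  fixes A :: "'z::real_inner \<Rightarrow> 'z set"
    and B :: "'z \<Rightarrow> 'z"
    and \<beta> \<gamma> :: real
    and R :: "'z \<Rightarrow> 'z"
    and zstar :: 'z
  assumes fin_dim: "\<exists>b::'z set. finite b \<and> span b = UNIV"
    and A: "maximal_monotone A"
    and beta: "\<beta> > 0"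
    and B: "(1 / \<beta>)-lipschitz_on UNIV B"
    and gamma: "\<gamma> > 0"
    and R: "R = fb_residual \<gamma> A B"
    and zstar: "R zstar = 0"
    and error_bound: "\<exists>\<kappa>>0. \<exists>\<delta>>0. \<forall>z. norm (R z) \<le> \<delta> \<longrightarrow>
          infdist z (op_inverse (\<lambda>z. {R z}) 0) \<le> \<kappa> * norm (R z)"
  shows "metrically_subregular (\<lambda>z. {R z}) zstar 0"
proof -
  from error_bound obtain \<kappa> \<delta> where "\<kappa> > 0" "\<delta> > 0"
    and "\<And>z. norm (R z) \<le> \<delta> \<Longrightarrow>
          infdist z (op_inverse (\<lambda>z. {R z}) 0) \<le> \<kappa> * norm (R z)"
    by blast
  with zstar show ?thesis
    by (rule metrically_subregular_if_residual_error_bound)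
qed

end
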